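(* Let $M := \{(x,y,z) \in \mathbb{C}^3 : x y - z^2 = 0\}$ and consider on $M$ the vector fields $$\Theta = 2 z \frac{\partial}{\partial x} + y \frac{\partial}{\partial z}, \qquad \Xi = 2 z \frac{\partial}{\partial y} + x \frac{\partial}{\partial z}, \qquad H = 2 y \frac{\partial}{\partial y} - 2 x \frac{\partial}{\partial x} = [\Theta, \Xi].$$ The four complete vector fields $\Xi$, $\Theta$, $z\,\Xi$, $z H$ generate the Lie algebra $$\{ f \cdot \Xi + g \cdot \Theta + h \cdot H : f, g, h \in \mathbb{C}[M] \}$$ on $M$.
   Context: $\mathbb{C}[M] = \mathbb{C}[x,y,z]/(xy-z^2)$ is the coordinate ring of $M$. Polynomial vector fields on $M$ are $\mathbb{C}$-linear derivations of $\mathbb{C}[M]$, with Lie bracket the commutator; $\Theta$, $\Xi$, $H$ are tangent to $M$ and are regarded as vector fields on $M$. "Generate" means generate as a complex Lie algebra. A holomorphic vector field is called complete if its flow exists for all complex times $t \in \mathbb{C}$. *)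

theory Defs
  imports Complex_Main HOL.Hull "HOL-Computational_Algebra.Polynomial"
begin

text \<open>
  The polynomial ring in \<open>x, y, z\<close> is rendered as iterated univariate polynomials: \<open>x\<close> is the
  innermost and \<open>z\<close> the outermost variable.
\<close>

type_synonym poly3 = "complex poly poly poly"

definition polyX :: poly3 where "polyX = [:[:[:0, 1:]:]:]"
definition polyY :: poly3 where "polyY = [:[:0, 1:]:]"
definition polyZ :: poly3 where "polyZ = [:0, 1:]"

definition eval3 :: "poly3 \<Rightarrow> complex \<times> complex \<times> complex \<Rightarrow> complex" where
  "eval3 p = (\<lambda>(a, b, c). poly (poly (poly p [:[:c:]:]) [:b:]) a)"

definition partialX :: "poly3 \<Rightarrow> poly3" where "partialX = map_poly (map_poly pderiv)"
definition partialY :: "poly3 \<Rightarrow> poly3" where "partialY = map_poly pderiv"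
definition partialZ :: "poly3 \<Rightarrow> poly3" where "partialZ = pderiv"

text \<open>The vector field \<open>a \<partial>/\<partial>x + b \<partial>/\<partial>y + c \<partial>/\<partial>z\<close> on affine 3-space.\<close>

definition field3 :: "poly3 \<Rightarrow> poly3 \<Rightarrow> poly3 \<Rightarrow> poly3 \<Rightarrow> poly3" where
  "field3 a b c p = a * partialX p + b * partialY p + c * partialZ p"

definition coneF :: poly3 where "coneF = polyX * polyY - polyZ ^ 2"

definition M :: "(complex \<times> complex \<times> complex) set" where
  "M = {(x, y, z). x * y - z ^ 2 = 0}"

lemma eval3_zero [simp]: "eval3 0 P = 0"
  and eval3_add: "eval3 (p + q) P = eval3 p P + eval3 q P"
  and eval3_diff: "eval3 (p - q) P = eval3 p P - eval3 q P"
  and eval3_mult: "eval3 (p * q) P = eval3 p P * eval3 q P"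
  by (simp_all add: eval3_def split: prod.splits)

lemma eval3_coneF: "P \<in> M \<Longrightarrow> eval3 coneF P = 0"
  by (auto simp: M_def eval3_def coneF_def polyX_def polyY_def polyZ_def power2_eq_square)

lemma map_poly_add_gen:
  assumes "f 0 = 0" "\<And>a b. f (a + b) = f a + f b"
  shows "map_poly f (p + q) = map_poly f p + map_poly f q"
  by (rule poly_eqI) (simp add: coeff_map_poly assms)

lemma map_poly_derivation:
  fixes f :: "'a :: comm_ring_1 \<Rightarrow> 'a"
  assumes z: "f 0 = 0" and a: "\<And>a b. f (a + b) = f a + f b"
    and m: "\<And>a b. f (a * b) = a * f b + b * f a"
  shows "map_poly f (p * q) = p * map_poly f q + q * map_poly f p"
proof -
  have smult: "map_poly f (smult c r) = smult c (map_poly f r) + smult (f c) r" for c r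
    by (rule poly_eqI) (simp add: coeff_map_poly z m algebra_simps)
  show ?thesis
    by (induction p)
       (simp_all add: z map_poly_add_gen[OF z a] smult map_poly_pCons algebra_simps)
qed

lemma partialX_add: "partialX (p + q) = partialX p + partialX q"
  and partialY_add: "partialY (p + q) = partialY p + partialY q"
  and partialZ_add: "partialZ (p + q) = partialZ p + partialZ q"
  by (simp_all add: partialX_def partialY_def partialZ_def map_poly_add_gen pderiv_add)

lemma partialZ_mult: "partialZ (p * q) = p * partialZ q + q * partialZ p"
  by (simp add: partialZ_def pderiv_mult)

lemma partialY_mult: "partialY (p * q) = p * partialY q + q * partialY p"
  unfolding partialY_def by (rule map_poly_derivation) (simp_all add: pderiv_add pderiv_mult)

lemma partialX_mult: "partialX (p * q) = p * partialX q + q * partialX p"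
  unfolding partialX_def
  by (intro map_poly_derivation)
     (simp_all add: map_poly_add_gen pderiv_add map_poly_derivation pderiv_mult)

lemma field3_add: "field3 a b c (p + q) = field3 a b c p + field3 a b c q"
  by (simp add: field3_def partialX_add partialY_add partialZ_add algebra_simps)

lemma field3_mult: "field3 a b c (p * q) = p * field3 a b c q + q * field3 a b c p"
  by (simp add: field3_def partialX_mult partialY_mult partialZ_mult algebra_simps)

lemma field3_tangent:
  assumes t: "field3 a b c coneF = 0" and d: "coneF dvd p - q"
  shows "coneF dvd field3 a b c p - field3 a b c q"
proof -
  obtain r where r: "p = q + coneF * r"
    using d by (metis add.commute diff_add_cancel dvdE)
  have "field3 a b c p - field3 a b c q = coneF * field3 a b c r"
    by (simp add: r field3_add field3_mult t)
  then show ?thesis by simp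
qed

lemma field3_coneF: "field3 a b c coneF = a * polyY + b * polyX - 2 * c * polyZ"
proof -
  have "partialX coneF = polyY" "partialY coneF = polyX" "partialZ coneF = - 2 * polyZ"
    by (simp_all add: partialX_def partialY_def partialZ_def coneF_def polyX_def polyY_def
        polyZ_def power2_eq_square pderiv_pCons map_poly_pCons numeral_poly one_pCons)
  then show ?thesis by (simp add: field3_def algebra_simps)
qed

text \<open>The coordinate ring of \<open>M\<close>: polynomials modulo the ideal generated by \<open>x y - z\<^sup>2\<close>.\<close>

quotient_type coord_ring = poly3 / "\<lambda>p q. coneF dvd p - q"
proof (intro equivpI reflpI sympI transpI)
  show "coneF dvd p - p" for p by simp
  show "coneF dvd q - p" if "coneF dvd p - q" for p q
    using that by (metis dvd_minus_iff minus_diff_eq)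
  show "coneF dvd p - r" if "coneF dvd p - q" "coneF dvd q - r" for p q r
    using dvd_add[OF that] by simp
qed

instantiation coord_ring :: comm_ring_1
begin

lift_definition zero_coord_ring :: coord_ring is 0 .

lift_definition one_coord_ring :: coord_ring is 1 .

lift_definition plus_coord_ring :: "coord_ring \<Rightarrow> coord_ring \<Rightarrow> coord_ring" is "(+)"
  by (metis add_diff_add dvd_add)

lift_definition uminus_coord_ring :: "coord_ring \<Rightarrow> coord_ring" is uminus
  by (metis dvd_diff_commute minus_diff_minus dvd_minus_iff)

lift_definition minus_coord_ring :: "coord_ring \<Rightarrow> coord_ring \<Rightarrow> coord_ring" is "(-)"
  by (metis (no_types, opaque_lifting) diff_diff_eq2 diff_add_eq add_diff_eq diff_diff_add
      add.commute dvd_diff)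

lift_definition times_coord_ring :: "coord_ring \<Rightarrow> coord_ring \<Rightarrow> coord_ring" is "(*)"
  by (simp add: mult_diff_mult dvd_add)

instance
proof
  have "\<not> coneF dvd 0 - 1"
  proof
    assume "coneF dvd 0 - 1"
    then obtain r where "(0 :: poly3) - 1 = coneF * r" by blast
    then have "eval3 0 (0, 0, 0) - eval3 1 (0, 0, 0) = eval3 (coneF * r) (0, 0, 0)"
      by (metis eval3_diff)
    moreover have "(0, 0, 0) \<in> M" by (simp add: M_def)
    ultimately show False by (simp add: eval3_mult eval3_coneF) (simp add: eval3_def)
  qed
  then show "(0 :: coord_ring) \<noteq> 1" by transfer
qed (transfer; simp add: algebra_simps)+

end

definition const_M :: "complex \<Rightarrow> coord_ring" where
  "const_M c = abs_coord_ring [:[:[:c:]:]:]"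

definition z_M :: coord_ring where "z_M = abs_coord_ring polyZ"

text \<open>The value of a regular function at a point; it is well defined only for points of \<open>M\<close>,
  and is set to \<open>0\<close> elsewhere.\<close>

lift_definition eval_M :: "coord_ring \<Rightarrow> complex \<times> complex \<times> complex \<Rightarrow> complex"
  is "\<lambda>p P. if P \<in> M then eval3 p P else 0"
proof (rule ext)
  fix p q :: poly3 and P
  assume d: "coneF dvd p - q"
  have "eval3 p P = eval3 q P" if "P \<in> M"
  proof -
    obtain r where "p - q = coneF * r" using d by blast
    then have "eval3 p P - eval3 q P = eval3 (coneF * r) P"
      by (metis eval3_diff)
    then show ?thesis using that by (simp add: eval3_mult eval3_coneF)
  qed
  then show "(if P \<in> M then eval3 p P else 0) = (if P \<in> M then eval3 q P else 0)" by simp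
qed

definition vector_fields :: "(coord_ring \<Rightarrow> coord_ring) set" where
  "vector_fields = {D. (\<forall>f g. D (f + g) = D f + D g) \<and> (\<forall>c f. D (const_M c * f) = const_M c * D f) \<and>
     (\<forall>f g. D (f * g) = f * D g + D f * g)}"

definition smult_field :: "coord_ring \<Rightarrow> (coord_ring \<Rightarrow> coord_ring) \<Rightarrow> coord_ring \<Rightarrow> coord_ring" where
  "smult_field h D = (\<lambda>f. h * D f)"

definition add_field ::
  "(coord_ring \<Rightarrow> coord_ring) \<Rightarrow> (coord_ring \<Rightarrow> coord_ring) \<Rightarrow> coord_ring \<Rightarrow> coord_ring" where
  "add_field D E = (\<lambda>f. D f + E f)"

definition lie_bracket ::
  "(coord_ring \<Rightarrow> coord_ring) \<Rightarrow> (coord_ring \<Rightarrow> coord_ring) \<Rightarrow> coord_ring \<Rightarrow> coord_ring" where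
  "lie_bracket D E = (\<lambda>f. D (E f) - E (D f))"

definition lie_subalgebra :: "(coord_ring \<Rightarrow> coord_ring) set \<Rightarrow> bool" where
  "lie_subalgebra L \<longleftrightarrow> L \<subseteq> vector_fields \<and> (\<lambda>_. 0) \<in> L \<and>
     (\<forall>D\<in>L. \<forall>E\<in>L. add_field D E \<in> L) \<and>
     (\<forall>c. \<forall>D\<in>L. smult_field (const_M c) D \<in> L) \<and>
     (\<forall>D\<in>L. \<forall>E\<in>L. lie_bracket D E \<in> L)"

text \<open>For \<open>S \<subseteq> vector_fields\<close> this is the smallest Lie subalgebra containing \<open>S\<close>
  (for other \<open>S\<close> the intersection is over the empty family).\<close>

definition lie_generated :: "(coord_ring \<Rightarrow> coord_ring) set \<Rightarrow> (coord_ring \<Rightarrow> coord_ring) set" where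
  "lie_generated S = lie_subalgebra hull S"

text \<open>\<open>\<phi>\<close> is a holomorphic integral curve of \<open>D\<close> in \<open>M\<close> for all complex times. Because \<open>M\<close> is
  singular, the equation \<open>\<phi>' = D(\<phi>)\<close> is tested against all regular functions; for the coordinate
  functions this is the usual system of differential equations.\<close>

definition entire_integral_curve ::
  "(coord_ring \<Rightarrow> coord_ring) \<Rightarrow> (complex \<Rightarrow> complex \<times> complex \<times> complex) \<Rightarrow> bool" where
  "entire_integral_curve D \<phi> \<longleftrightarrow> range \<phi> \<subseteq> M \<and>
     (\<forall>f t. ((\<lambda>s. eval_M f (\<phi> s)) has_field_derivative eval_M (D f) (\<phi> t)) (at t))"

definition complete_vector_field :: "(coord_ring \<Rightarrow> coord_ring) \<Rightarrow> bool" where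
  "complete_vector_field D \<longleftrightarrow> D \<in> vector_fields \<and>
     (\<forall>P\<in>M. \<exists>\<phi>. \<phi> 0 = P \<and> entire_integral_curve D \<phi>)"

text \<open>The proof obligations of the following lifts are precisely tangency to \<open>M\<close>.\<close>

lift_definition Theta_M :: "coord_ring \<Rightarrow> coord_ring" is "field3 (2 * polyZ) 0 polyY"
  by (rule field3_tangent) (simp_all add: field3_coneF)

lift_definition Xi_M :: "coord_ring \<Rightarrow> coord_ring" is "field3 0 (2 * polyZ) polyX"
  by (rule field3_tangent) (simp_all add: field3_coneF)

lift_definition H_M :: "coord_ring \<Rightarrow> coord_ring" is "field3 (- 2 * polyX) (2 * polyY) 0"
  by (rule field3_tangent) (simp_all add: field3_coneF)

end

theory Submission
  imports Defs
begin

text \<open>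
  The fields \<open>\<Xi>, \<Theta>, H\<close> span a copy of \<open>sl\<^sub>2\<close>, since \<open>[\<Theta>, \<Xi>] = H\<close>, \<open>[H, \<Theta>] = 2 \<Theta>\<close> and
  \<open>[H, \<Xi>] = - 2 \<Xi>\<close>, and they act on the three coordinate functions as on the adjoint
  representation. By the Leibniz rule \<open>[a X, b Y] = a X(b) Y - b Y(a) X + a b [X, Y]\<close>, the fields
  \<open>f \<Xi> + g \<Theta> + h H\<close> form a Lie algebra. It contains the four generators, so it contains the Lie
  algebra that they generate.

  For the converse, let \<open>L\<close> be any Lie algebra containing the generators, and let \<open>A\<close> be the set
  of all functions \<open>f\<close> with \<open>f \<Xi>, f \<Theta>, f H \<in> L\<close> (\<open>coefficients\<close> below). It is a linear subspace. A few
  brackets of the generators show that \<open>1\<close> and \<open>x\<close> lie in \<open>A\<close> (\<open>generators_give_coefficients\<close>).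
  It remains to see that \<open>A\<close> is closed under multiplication by \<open>x, y, z\<close>
  (\<open>coefficients_mult_coordinates\<close>), for then \<open>A\<close> contains all polynomials.

  So let \<open>f \<in> A\<close>. As \<open>sl\<^sub>2 \<subseteq> L\<close>, also \<open>\<Xi> f, \<Theta> f, H f \<in> A\<close>. Bracketing \<open>x \<Xi>, x \<Theta>, x H\<close> with
  \<open>f \<Xi>\<close> and \<open>f H\<close> gives, modulo \<open>L\<close>, relations such as \<open>x H(f) \<Xi> \<equiv> 2 x f \<Xi>\<close> and
  \<open>x H(f) H \<equiv> - 2 x f H\<close>, which say that \<open>x f \<Xi>\<close> and \<open>x f H\<close> can be nonzero modulo \<open>L\<close> only
  on particular weights of \<open>f\<close>. The relation \<open>x f H \<equiv> - x \<Theta>(f) \<Xi>\<close> links the two, but \<open>\<Theta>\<close>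
  shifts weights, and the weights that it requires are incompatible. Hence \<open>x f H \<equiv> 0\<close>, and then
  \<open>x f \<Xi> \<equiv> 0\<close>. All other products are reached by applying \<open>[\<Theta>, _]\<close>, which lowers \<open>x\<close> to \<open>2 z\<close>
  and \<open>z\<close> to \<open>y\<close>. The sole ambiguity, between \<open>x f \<Theta>\<close> and \<open>z f H\<close>, is resolved by the syzygy
  \<open>y \<Xi> = x \<Theta> + z H\<close>, which holds because on \<open>M\<close> the three fields are tangent to a surface.
  The argument works with these relations as operator identities and never needs a decomposition
  of the ring into weight spaces.

  Completeness is shown by writing down the flows. For \<open>\<Xi>\<close> and \<open>\<Theta>\<close> they are polynomial in
  the time. For \<open>z \<Xi>\<close> and \<open>z H\<close> they are exponential, because \<open>x\<close>, respectively \<open>z\<close>, is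
  constant along the flow.
\<close>

section \<open>The coordinate ring\<close>

definition x_M :: coord_ring where "x_M = abs_coord_ring polyX"
definition y_M :: coord_ring where "y_M = abs_coord_ring polyY"

lemma abs_coord_ring_add: "abs_coord_ring (p + q) = abs_coord_ring p + abs_coord_ring q"
  and abs_coord_ring_mult: "abs_coord_ring (p * q) = abs_coord_ring p * abs_coord_ring q"
  by (simp_all add: plus_coord_ring.abs_eq times_coord_ring.abs_eq)

lemma abs_coord_ring_of_nat: "abs_coord_ring (of_nat n) = of_nat n"
  by (induction n) (simp_all add: abs_coord_ring_add zero_coord_ring_def one_coord_ring_def)

lemma abs_coord_ring_numeral: "abs_coord_ring (numeral n) = numeral n"
  using abs_coord_ring_of_nat [of "numeral n"] by simp

lemma xy_eq_z2: "x_M * y_M = z_M * z_M"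
  unfolding x_M_def y_M_def z_M_def abs_coord_ring_mult [symmetric]
  by (simp add: coord_ring.abs_eq_iff coneF_def power2_eq_square)

lemma const_M_0 [simp]: "const_M 0 = 0"
  and const_M_1 [simp]: "const_M 1 = 1"
  and const_M_add: "const_M (a + b) = const_M a + const_M b"
  and const_M_uminus: "const_M (- a) = - const_M a"
  by (simp_all add: const_M_def zero_coord_ring_def one_coord_ring_def uminus_coord_ring.abs_eq
      flip: abs_coord_ring_add abs_coord_ring_mult one_pCons)

lemma const_M_mult: "const_M (a * b) = const_M a * const_M b"
  by (simp add: const_M_def mult.commute flip: abs_coord_ring_mult)

lemma const_M_of_nat: "const_M (of_nat n) = of_nat n"
  by (induction n) (simp_all add: const_M_add)

lemma const_M_numeral: "const_M (numeral n) = numeral n"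
  using const_M_of_nat [of "numeral n"] by simp

lemma coord_ring_induct [case_names const add x y z]:
  assumes const: "\<And>c. P (const_M c)" and add: "\<And>f g. P f \<Longrightarrow> P g \<Longrightarrow> P (f + g)"
    and x: "\<And>f. P f \<Longrightarrow> P (x_M * f)" and y: "\<And>f. P f \<Longrightarrow> P (y_M * f)"
    and z: "\<And>f. P f \<Longrightarrow> P (z_M * f)"
  shows "P f"
proof -
  have P0: "P (abs_coord_ring 0)"
    using const [of 0] by (simp add: zero_coord_ring_def)
  have 1: "P (abs_coord_ring [:[:p:]:])" for p
  proof (induction p)
    case (pCons c p)
    have "[:[:pCons c p:]:] = [:[:[:c:]:]:] + polyX * [:[:p:]:]"
      by (simp add: polyX_def)
    then have "abs_coord_ring [:[:pCons c p:]:] = const_M c + x_M * abs_coord_ring [:[:p:]:]"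
      by (simp only: abs_coord_ring_add abs_coord_ring_mult x_M_def const_M_def)
    then show ?case
      using add [OF const x [OF pCons.IH]] by simp
  qed (simp add: P0)
  have 2: "P (abs_coord_ring [:p:])" for p
  proof (induction p)
    case (pCons c p)
    have "[:pCons c p:] = [:[:c:]:] + polyY * [:p:]"
      by (simp add: polyY_def)
    then have "abs_coord_ring [:pCons c p:] = abs_coord_ring [:[:c:]:] + y_M * abs_coord_ring [:p:]"
      by (simp only: abs_coord_ring_add abs_coord_ring_mult y_M_def)
    then show ?case
      using add [OF 1 y [OF pCons.IH]] by simp
  qed (simp add: P0)
  have 3: "P (abs_coord_ring p)" for p
  proof (induction p)
    case (pCons c p)
    have "pCons c p = [:c:] + polyZ * p"
      by (simp add: polyZ_def)
    then have "abs_coord_ring (pCons c p) = abs_coord_ring [:c:] + z_M * abs_coord_ring p"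
      by (simp only: abs_coord_ring_add abs_coord_ring_mult z_M_def)
    then show ?case
      using add [OF 2 z [OF pCons.IH]] by simp
  qed (simp add: P0)
  show ?thesis
    by (induction f rule: coord_ring.abs_induct) (rule 3)
qed

lemma eval_M_add: "eval_M (f + g) P = eval_M f P + eval_M g P"
  by transfer (simp add: eval3_add)

lemma eval_M_mult: "eval_M (f * g) P = eval_M f P * eval_M g P"
  by transfer (simp add: eval3_mult)

lemma eval_M_const: "P \<in> M \<Longrightarrow> eval_M (const_M c) P = c"
  by (cases P) (simp add: const_M_def eval_M.abs_eq eval3_def)

lemma eval_M_numeral: "P \<in> M \<Longrightarrow> eval_M (numeral n) P = numeral n"
  using eval_M_const [of P "numeral n"] by (simp add: const_M_numeral)

lemma eval_M_coordinates:
  assumes "(a, b, c) \<in> M"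
  shows "eval_M x_M (a, b, c) = a" "eval_M y_M (a, b, c) = b" "eval_M z_M (a, b, c) = c"
  using assms
  by (simp_all add: x_M_def y_M_def z_M_def eval_M.abs_eq eval3_def polyX_def polyY_def polyZ_def)

section \<open>Vector fields\<close>

lemma vector_fieldD:
  assumes "D \<in> vector_fields"
  shows "D (f + g) = D f + D g" "D (f * g) = f * D g + D f * g"
    "D (const_M c) = 0" "D 0 = 0" "D 1 = 0" "D (- f) = - D f" "D (f - g) = D f - D g"
    "D (numeral n) = 0"
proof -
  show add: "D (f + g) = D f + D g" for f g
    using assms by (simp add: vector_fields_def)
  show mult: "D (f * g) = f * D g + D f * g" for f g
    using assms by (simp add: vector_fields_def)
  show 1: "D 1 = 0"
    using mult [of 1 1] by simp
  show const: "D (const_M c) = 0" for c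
  proof -
    have "D (const_M c * 1) = const_M c * D 1"
      using assms unfolding vector_fields_def by blast
    then show ?thesis by (simp add: 1)
  qed
  show 0: "D 0 = 0"
    using add [of 0 0] by simp
  show neg: "D (- f) = - D f" for f
    using add [of f "- f"] by (simp add: 0 eq_neg_iff_add_eq_0 add.commute)
  show "D (f - g) = D f - D g"
    using add [of f "- g"] by (simp add: neg)
  show "D (numeral n) = 0"
    using const [of "numeral n"] by (simp add: const_M_numeral)
qed

lemma vector_fieldI:
  assumes "\<And>f g. D (f + g) = D f + D g" "\<And>f g. D (f * g) = f * D g + D f * g"
    "\<And>c. D (const_M c) = 0"
  shows "D \<in> vector_fields"
  using assms by (simp add: vector_fields_def)

text \<open>The derivations of \<open>\<complex>[M]\<close> are determined by their values on the generators of the ring. This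
  turns every identity between concrete vector fields into three identities in the ring.\<close>

lemma vector_field_eqI:
  assumes "D \<in> vector_fields" "E \<in> vector_fields"
    and "D x_M = E x_M" "D y_M = E y_M" "D z_M = E z_M"
  shows "D = E"
proof
  fix f
  show "D f = E f"
    by (induction f rule: coord_ring_induct)
       (simp_all add: assms vector_fieldD [OF assms(1)] vector_fieldD [OF assms(2)])
qed

lemma add_field_vector_field:
  assumes "D \<in> vector_fields" "E \<in> vector_fields"
  shows "add_field D E \<in> vector_fields"
  by (rule vector_fieldI)
     (simp_all add: add_field_def vector_fieldD [OF assms(1)] vector_fieldD [OF assms(2)]
       algebra_simps)

lemma smult_field_vector_field:
  assumes "D \<in> vector_fields"
  shows "smult_field h D \<in> vector_fields"
  by (rule vector_fieldI) (simp_all add: smult_field_def vector_fieldD [OF assms] algebra_simps)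

lemma lie_bracket_vector_field:
  assumes "D \<in> vector_fields" "E \<in> vector_fields"
  shows "lie_bracket D E \<in> vector_fields"
  by (rule vector_fieldI)
     (simp_all add: lie_bracket_def vector_fieldD [OF assms(1)] vector_fieldD [OF assms(2)]
       algebra_simps)

lemma partial_coordinates:
  "partialX polyX = 1" "partialX polyY = 0" "partialX polyZ = 0"
  "partialY polyX = 0" "partialY polyY = 1" "partialY polyZ = 0"
  "partialZ polyX = 0" "partialZ polyY = 0" "partialZ polyZ = 1"
  by (simp_all add: partialX_def partialY_def partialZ_def polyX_def polyY_def
      polyZ_def pderiv_pCons map_poly_pCons one_pCons)

lemma field3_const: "field3 a b c [:[:[:k:]:]:] = 0"
  by (simp add: field3_def partialX_def partialY_def partialZ_def pderiv_pCons map_poly_pCons)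

lemma field3_lift_vector_field:
  assumes "\<And>p. D (abs_coord_ring p) = abs_coord_ring (field3 a b c p)"
  shows "D \<in> vector_fields"
proof (rule vector_fieldI)
  show "D (f + g) = D f + D g" for f g
    by (induction f rule: coord_ring.abs_induct; induction g rule: coord_ring.abs_induct)
       (simp add: assms field3_add flip: abs_coord_ring_add)
  show "D (f * g) = f * D g + D f * g" for f g
    by (induction f rule: coord_ring.abs_induct; induction g rule: coord_ring.abs_induct)
       (simp add: assms field3_mult ac_simps flip: abs_coord_ring_add abs_coord_ring_mult)
  show "D (const_M k) = 0" for k
    by (simp add: const_M_def assms field3_const zero_coord_ring_def)
qed

lemma Xi_vector_field: "Xi_M \<in> vector_fields"
  and Theta_vector_field: "Theta_M \<in> vector_fields"
  and H_vector_field: "H_M \<in> vector_fields"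
  by (rule field3_lift_vector_field, rule Xi_M.abs_eq Theta_M.abs_eq H_M.abs_eq)+

lemmas sl2_vector_fieldD =
  vector_fieldD [OF Xi_vector_field] vector_fieldD [OF Theta_vector_field]
  vector_fieldD [OF H_vector_field]

lemma sl2_coordinates:
  "Xi_M x_M = 0" "Xi_M y_M = 2 * z_M" "Xi_M z_M = x_M"
  "Theta_M x_M = 2 * z_M" "Theta_M y_M = 0" "Theta_M z_M = y_M"
  "H_M x_M = - 2 * x_M" "H_M y_M = 2 * y_M" "H_M z_M = 0"
  by (simp_all add: x_M_def y_M_def z_M_def Xi_M.abs_eq Theta_M.abs_eq H_M.abs_eq
      field3_def partial_coordinates abs_coord_ring_mult abs_coord_ring_numeral
      flip: zero_coord_ring_def uminus_coord_ring.abs_eq)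

lemma bracket_Theta_Xi: "lie_bracket Theta_M Xi_M = H_M"
  and bracket_H_Theta: "lie_bracket H_M Theta_M = smult_field 2 Theta_M"
  and bracket_H_Xi: "lie_bracket H_M Xi_M = smult_field (- 2) Xi_M"
  by (rule vector_field_eqI;
      (intro lie_bracket_vector_field smult_field_vector_field Xi_vector_field
        Theta_vector_field H_vector_field)?;
      simp add: lie_bracket_def smult_field_def sl2_coordinates sl2_vector_fieldD)+

text \<open>Oriented so that rewriting moves \<open>\<Theta>\<close> and \<open>\<Xi>\<close> inwards past \<open>H\<close>, and \<open>\<Theta>\<close> inwards past \<open>\<Xi>\<close>.\<close>

lemma sl2_commute:
  "Theta_M (Xi_M f) = Xi_M (Theta_M f) + H_M f"
  "Theta_M (H_M f) = H_M (Theta_M f) - 2 * Theta_M f"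
  "Xi_M (H_M f) = H_M (Xi_M f) + 2 * Xi_M f"
  using fun_cong [OF bracket_Theta_Xi, of f] fun_cong [OF bracket_H_Theta, of f]
    fun_cong [OF bracket_H_Xi, of f]
  by (simp_all add: lie_bracket_def smult_field_def algebra_simps)

text \<open>The tangent spaces of \<open>M\<close> have dimension two at smooth points, so the three fields must be
  linearly dependent over \<open>\<complex>[M]\<close>. The dependence is where the equation \<open>x y = z\<^sup>2\<close> enters the
  computation of the generated Lie algebra.\<close>

lemma sl2_syzygy: "y_M * Xi_M p = x_M * Theta_M p + z_M * H_M p"
proof -
  have "smult_field y_M Xi_M = add_field (smult_field x_M Theta_M) (smult_field z_M H_M)"
    by (rule vector_field_eqI;
        (intro add_field_vector_field smult_field_vector_field Xi_vector_field
          Theta_vector_field H_vector_field)?;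
        simp add: add_field_def smult_field_def sl2_coordinates xy_eq_z2 algebra_simps)
  then show ?thesis
    by (simp add: add_field_def smult_field_def fun_eq_iff)
qed

section \<open>Completeness\<close>

text \<open>An integral curve is tested against all regular functions. By the product rule it suffices to
  test it against the coordinate functions, which gives the usual differential equations.\<close>

lemma entire_integral_curveI:
  assumes D: "D \<in> vector_fields" and M: "\<And>t. (a t, b t, c t) \<in> M"
    and a: "\<And>t. (a has_field_derivative eval_M (D x_M) (a t, b t, c t)) (at t)"
    and b: "\<And>t. (b has_field_derivative eval_M (D y_M) (a t, b t, c t)) (at t)"
    and c: "\<And>t. (c has_field_derivative eval_M (D z_M) (a t, b t, c t)) (at t)"
  shows "entire_integral_curve D (\<lambda>t. (a t, b t, c t))"
proof -
  have "((\<lambda>s. eval_M f (a s, b s, c s)) has_field_derivative eval_M (D f) (a t, b t, c t)) (at t)"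
    for f t
  proof (induction f rule: coord_ring_induct)
    case (const k)
    then show ?case
      using eval_M_const [OF M, of 0] by (simp add: vector_fieldD [OF D] eval_M_const M)
  next
    case (add f g)
    then show ?case
      by (simp add: vector_fieldD [OF D] eval_M_add DERIV_add)
  next
    case (x f)
    show ?case
      using DERIV_mult [OF a x]
      by (simp add: vector_fieldD [OF D] eval_M_add eval_M_mult eval_M_coordinates M algebra_simps)
  next
    case (y f)
    show ?case
      using DERIV_mult [OF b y]
      by (simp add: vector_fieldD [OF D] eval_M_add eval_M_mult eval_M_coordinates M algebra_simps)
  next
    case (z f)
    show ?case
      using DERIV_mult [OF c z]
      by (simp add: vector_fieldD [OF D] eval_M_add eval_M_mult eval_M_coordinates M algebra_simps)
  qed
  with M show ?thesis
    by (auto simp: entire_integral_curve_def)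
qed

lemma complete_vector_fieldI:
  assumes "D \<in> vector_fields"
    and "\<And>x y z. (x, y, z) \<in> M \<Longrightarrow> \<exists>a b c. a 0 = x \<and> b 0 = y \<and> c 0 = z \<and>
      entire_integral_curve D (\<lambda>t. (a t, b t, c t))"
  shows "complete_vector_field D"
proof -
  have "\<exists>\<phi>. \<phi> 0 = P \<and> entire_integral_curve D \<phi>" if P: "P \<in> M" for P
  proof -
    obtain x y z where xyz: "P = (x, y, z)" by (cases P)
    then show ?thesis
      using assms(2) [of x y z] P by fastforce
  qed
  with assms(1) show ?thesis
    by (simp add: complete_vector_field_def)
qed

lemma M_iff: "(x, y, z) \<in> M \<longleftrightarrow> x * y = z * z"
  by (simp add: M_def power2_eq_square)

lemma eval_M_0 [simp]: "eval_M 0 P = 0"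
  by transfer simp

lemma eval_M_uminus: "eval_M (- f) P = - eval_M f P"
  using eval_M_add [of f "- f" P] by (simp add: eq_neg_iff_add_eq_0 add.commute)

lemmas eval_M_simps =
  smult_field_def sl2_coordinates eval_M_0 eval_M_mult eval_M_uminus eval_M_numeral
  eval_M_coordinates

lemma complete_Theta: "complete_vector_field Theta_M"
proof (rule complete_vector_fieldI [OF Theta_vector_field])
  fix x y z :: complex
  assume xyz: "(x, y, z) \<in> M"
  have inM: "(x + 2 * t * z + t * t * y, y, z + t * y) \<in> M" for t
    using xyz by (simp add: M_iff algebra_simps)
  have "entire_integral_curve Theta_M (\<lambda>t. (x + 2 * t * z + t * t * y, y, z + t * y))"
    by (rule entire_integral_curveI [OF Theta_vector_field inM])
       (simp_all only: eval_M_simps inM, auto simp: algebra_simps intro!: derivative_eq_intros)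
  then show "\<exists>a b c. a 0 = x \<and> b 0 = y \<and> c 0 = z \<and>
      entire_integral_curve Theta_M (\<lambda>t. (a t, b t, c t))"
    by (intro exI [of _ "\<lambda>t. x + 2 * t * z + t * t * y"] exI [of _ "\<lambda>_. y"]
        exI [of _ "\<lambda>t. z + t * y"]) simp
qed

lemma complete_Xi: "complete_vector_field Xi_M"
proof (rule complete_vector_fieldI [OF Xi_vector_field])
  fix x y z :: complex
  assume xyz: "(x, y, z) \<in> M"
  have inM: "(x, y + 2 * t * z + t * t * x, z + t * x) \<in> M" for t
    using xyz by (simp add: M_iff algebra_simps)
  have "entire_integral_curve Xi_M (\<lambda>t. (x, y + 2 * t * z + t * t * x, z + t * x))"
    by (rule entire_integral_curveI [OF Xi_vector_field inM])
       (simp_all only: eval_M_simps inM, auto simp: algebra_simps intro!: derivative_eq_intros)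
  then show "\<exists>a b c. a 0 = x \<and> b 0 = y \<and> c 0 = z \<and>
      entire_integral_curve Xi_M (\<lambda>t. (a t, b t, c t))"
    by (intro exI [of _ "\<lambda>_. x"] exI [of _ "\<lambda>t. y + 2 * t * z + t * t * x"]
        exI [of _ "\<lambda>t. z + t * x"]) simp
qed

text \<open>Here \<open>x' = 0\<close> and \<open>z' = x z\<close>. On \<open>M\<close> the remaining equation \<open>y' = 2 z\<^sup>2\<close> becomes the linear
  equation \<open>y' = 2 x y\<close>, whose solution needs no division by \<open>x\<close>.\<close>

lemma complete_z_Xi: "complete_vector_field (smult_field z_M Xi_M)"
proof (rule complete_vector_fieldI [OF smult_field_vector_field [OF Xi_vector_field]])
  fix x y z :: complex
  assume xyz: "(x, y, z) \<in> M"
  have inM: "(x, y * exp (x * t) * exp (x * t), z * exp (x * t)) \<in> M" for t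
    using xyz by (simp add: M_iff algebra_simps)
  have zz: "z * (z * w) = x * (y * w)" for w
    using xyz by (simp add: M_iff flip: mult.assoc)
  have "entire_integral_curve (smult_field z_M Xi_M)
      (\<lambda>t. (x, y * exp (x * t) * exp (x * t), z * exp (x * t)))"
    by (rule entire_integral_curveI [OF smult_field_vector_field [OF Xi_vector_field] inM])
       (simp_all only: eval_M_simps inM, auto simp: zz algebra_simps intro!: derivative_eq_intros)
  then show "\<exists>a b c. a 0 = x \<and> b 0 = y \<and> c 0 = z \<and>
      entire_integral_curve (smult_field z_M Xi_M) (\<lambda>t. (a t, b t, c t))"
    by (intro exI [of _ "\<lambda>_. x"] exI [of _ "\<lambda>t. y * exp (x * t) * exp (x * t)"]
        exI [of _ "\<lambda>t. z * exp (x * t)"]) simp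
qed

lemma complete_z_H: "complete_vector_field (smult_field z_M H_M)"
proof (rule complete_vector_fieldI [OF smult_field_vector_field [OF H_vector_field]])
  fix x y z :: complex
  assume xyz: "(x, y, z) \<in> M"
  have inM: "(x * exp (- (2 * z * t)), y * exp (2 * z * t), z) \<in> M" for t
    using xyz by (simp add: M_iff exp_minus field_simps)
  have "entire_integral_curve (smult_field z_M H_M)
      (\<lambda>t. (x * exp (- (2 * z * t)), y * exp (2 * z * t), z))"
    by (rule entire_integral_curveI [OF smult_field_vector_field [OF H_vector_field] inM])
       (simp_all only: eval_M_simps inM, auto simp: algebra_simps intro!: derivative_eq_intros)
  then show "\<exists>a b c. a 0 = x \<and> b 0 = y \<and> c 0 = z \<and>
      entire_integral_curve (smult_field z_M H_M) (\<lambda>t. (a t, b t, c t))"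
    by (intro exI [of _ "\<lambda>t. x * exp (- (2 * z * t))"] exI [of _ "\<lambda>t. y * exp (2 * z * t)"]
        exI [of _ "\<lambda>_. z"]) simp
qed

section \<open>The generated Lie algebra\<close>

definition sl2_field :: "coord_ring \<Rightarrow> coord_ring \<Rightarrow> coord_ring \<Rightarrow> coord_ring \<Rightarrow> coord_ring" where
  "sl2_field f g h = add_field (smult_field f Xi_M) (add_field (smult_field g Theta_M) (smult_field h H_M))"

lemma sl2_field_apply: "sl2_field f g h p = f * Xi_M p + g * Theta_M p + h * H_M p"
  by (simp add: sl2_field_def add_field_def smult_field_def)

lemma sl2_field_vector_field: "sl2_field f g h \<in> vector_fields"
  by (simp add: sl2_field_def add_field_vector_field smult_field_vector_field Xi_vector_field
      Theta_vector_field H_vector_field)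

lemma add_sl2_field:
  "add_field (sl2_field f g h) (sl2_field f' g' h') = sl2_field (f + f') (g + g') (h + h')"
  by (simp add: fun_eq_iff sl2_field_apply add_field_def algebra_simps)

lemma smult_sl2_field: "smult_field k (sl2_field f g h) = sl2_field (k * f) (k * g) (k * h)"
  by (simp add: fun_eq_iff sl2_field_apply smult_field_def algebra_simps)

lemma bracket_sl2_field:
  "lie_bracket (sl2_field f g h) (sl2_field f' g' h') =
    sl2_field
      (sl2_field f g h f' - sl2_field f' g' h' f + 2 * (f * h' - h * f'))
      (sl2_field f g h g' - sl2_field f' g' h' g + 2 * (h * g' - g * h'))
      (sl2_field f g h h' - sl2_field f' g' h' h + (g * f' - f * g'))"
  by (rule ext)
     (simp add: lie_bracket_def sl2_field_apply sl2_vector_fieldD sl2_commute algebra_simps)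

lemma lie_subalgebra_sl2_fields: "lie_subalgebra {sl2_field f g h | f g h. True}"
proof -
  have "(\<lambda>_. 0) = sl2_field 0 0 0"
    by (simp add: fun_eq_iff sl2_field_apply)
  then show ?thesis
    unfolding lie_subalgebra_def
    by (auto simp: sl2_field_vector_field add_sl2_field smult_sl2_field bracket_sl2_field) blast+
qed

text \<open>The factors that may be put in front of each of the three fields without leaving \<open>L\<close>. The
  condition on all three at once makes this set stable under the action of \<open>sl\<^sub>2\<close>.\<close>

definition coefficients :: "(coord_ring \<Rightarrow> coord_ring) set \<Rightarrow> coord_ring set" where
  "coefficients L = {f. sl2_field f 0 0 \<in> L \<and> sl2_field 0 f 0 \<in> L \<and> sl2_field 0 0 f \<in> L}"

context
  fixes L
  assumes L: "lie_subalgebra L"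
begin

text \<open>The closure properties of \<open>L\<close> are stated with the resulting coefficients \<open>p, q, r\<close> as variables
  subject to equations. An application then states the coefficients in the form it wants, and
  what is left are identities in the ring.\<close>

lemma add_mem:
  assumes "sl2_field f g h \<in> L" "sl2_field f' g' h' \<in> L"
    and "p = f + f'" "q = g + g'" "r = h + h'"
  shows "sl2_field p q r \<in> L"
  using L assms by (simp add: lie_subalgebra_def flip: add_sl2_field)

lemma scale_mem:
  assumes "sl2_field f g h \<in> L"
  shows "sl2_field (const_M c * f) (const_M c * g) (const_M c * h) \<in> L"
  using L assms by (simp add: lie_subalgebra_def flip: smult_sl2_field)

lemma diff_mem:
  assumes "sl2_field f g h \<in> L" "sl2_field f' g' h' \<in> L"
    and "p = f - f'" "q = g - g'" "r = h - h'"
  shows "sl2_field p q r \<in> L"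
  by (rule add_mem [OF assms(1) scale_mem [OF assms(2), of "- 1"]])
     (simp_all add: assms const_M_uminus)

lemma cancel_mem:
  assumes "sl2_field f g h \<in> L"
    and "f = numeral n * p" "g = numeral n * q" "h = numeral n * r"
  shows "sl2_field p q r \<in> L"
proof -
  have "const_M (1 / numeral n) * (numeral n * k) = k" for k
    by (simp flip: mult.assoc const_M_numeral const_M_mult)
  then show ?thesis
    using scale_mem [OF assms(1), of "1 / numeral n"] by (simp add: assms)
qed

lemma bracket_mem:
  assumes "sl2_field f g h \<in> L" "sl2_field f' g' h' \<in> L"
    and "p = sl2_field f g h f' - sl2_field f' g' h' f + 2 * (f * h' - h * f')"
    and "q = sl2_field f g h g' - sl2_field f' g' h' g + 2 * (h * g' - g * h')"
    and "r = sl2_field f g h h' - sl2_field f' g' h' h + (g * f' - f * g')"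
  shows "sl2_field p q r \<in> L"
proof -
  have "lie_bracket (sl2_field f g h) (sl2_field f' g' h') \<in> L"
    using L assms(1,2) unfolding lie_subalgebra_def by blast
  then show ?thesis
    by (simp only: bracket_sl2_field assms(3-5))
qed

text \<open>The three coefficients of a field are not unique: multiples of the syzygy can be added.\<close>

lemma syzygy_mem:
  assumes "sl2_field f g h \<in> L"
    and "p = f + k * y_M" "q = g - k * x_M" "r = h - k * z_M"
  shows "sl2_field p q r \<in> L"
proof -
  have "sl2_field p q r = sl2_field f g h"
  proof
    fix w
    have "sl2_field p q r w = sl2_field f g h w
        + k * (y_M * Xi_M w - (x_M * Theta_M w + z_M * H_M w))"
      unfolding assms sl2_field_apply by (simp add: algebra_simps)
    then show "sl2_field p q r w = sl2_field f g h w"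
      by (simp add: sl2_syzygy)
  qed
  with assms(1) show ?thesis by simp
qed

lemmas bracket_simps = sl2_field_apply sl2_vector_fieldD sl2_coordinates sl2_commute

lemma coefficientsD:
  assumes "f \<in> coefficients L"
  shows "sl2_field f 0 0 \<in> L" "sl2_field 0 f 0 \<in> L" "sl2_field 0 0 f \<in> L"
  using assms by (simp_all add: coefficients_def)

lemma coefficientsI:
  assumes "sl2_field f 0 0 \<in> L" "sl2_field 0 f 0 \<in> L" "sl2_field 0 0 f \<in> L"
  shows "f \<in> coefficients L"
  using assms by (simp add: coefficients_def)

text \<open>For \<open>X, Y \<in> sl\<^sub>2\<close> one has \<open>[X, f Y] = X(f) Y + f [X, Y]\<close>, and \<open>f [X, Y]\<close> is in \<open>L\<close> because
  \<open>[X, Y]\<close> is again a combination of the three fields.\<close>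

lemma coefficients_sl2_stable:
  assumes 1: "1 \<in> coefficients L" and f: "f \<in> coefficients L"
  shows "Xi_M f \<in> coefficients L" "Theta_M f \<in> coefficients L" "H_M f \<in> coefficients L"
proof -
  note m = coefficientsD [OF 1] coefficientsD [OF f]
  have "sl2_field (Xi_M f) 0 0 \<in> L"
    by (rule bracket_mem [OF m(1) m(4)]) (simp_all add: bracket_simps)
  moreover have "sl2_field 0 (Xi_M f) (- f) \<in> L"
    by (rule bracket_mem [OF m(1) m(5)]) (simp_all add: bracket_simps)
  then have "sl2_field 0 (Xi_M f) 0 \<in> L"
    by (rule add_mem [OF _ m(6)]) simp_all
  moreover have "sl2_field (2 * f) 0 (Xi_M f) \<in> L"
    by (rule bracket_mem [OF m(1) m(6)]) (simp_all add: bracket_simps)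
  then have "sl2_field f 0 (Xi_M f) \<in> L"
    by (rule diff_mem [OF _ m(4)]) simp_all
  then have "sl2_field 0 0 (Xi_M f) \<in> L"
    by (rule diff_mem [OF _ m(4)]) simp_all
  ultimately show "Xi_M f \<in> coefficients L"
    by (simp add: coefficients_def)
  have "sl2_field (Theta_M f) 0 f \<in> L"
    by (rule bracket_mem [OF m(2) m(4)]) (simp_all add: bracket_simps)
  then have "sl2_field (Theta_M f) 0 0 \<in> L"
    by (rule diff_mem [OF _ m(6)]) simp_all
  moreover have "sl2_field 0 (Theta_M f) 0 \<in> L"
    by (rule bracket_mem [OF m(2) m(5)]) (simp_all add: bracket_simps)
  moreover have "sl2_field 0 (- 2 * f) (Theta_M f) \<in> L"
    by (rule bracket_mem [OF m(2) m(6)]) (simp_all add: bracket_simps)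
  then have "sl2_field 0 (- f) (Theta_M f) \<in> L"
    by (rule add_mem [OF _ m(5)]) simp_all
  then have "sl2_field 0 0 (Theta_M f) \<in> L"
    by (rule add_mem [OF _ m(5)]) simp_all
  ultimately show "Theta_M f \<in> coefficients L"
    by (simp add: coefficients_def)
  have "sl2_field (H_M f - 2 * f) 0 0 \<in> L"
    by (rule bracket_mem [OF m(3) m(4)]) (simp_all add: bracket_simps)
  then have "sl2_field (H_M f - f) 0 0 \<in> L"
    by (rule add_mem [OF _ m(4)]) simp_all
  then have "sl2_field (H_M f) 0 0 \<in> L"
    by (rule add_mem [OF _ m(4)]) simp_all
  moreover have "sl2_field 0 (H_M f + 2 * f) 0 \<in> L"
    by (rule bracket_mem [OF m(3) m(5)]) (simp_all add: bracket_simps)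
  then have "sl2_field 0 (H_M f + f) 0 \<in> L"
    by (rule diff_mem [OF _ m(5)]) simp_all
  then have "sl2_field 0 (H_M f) 0 \<in> L"
    by (rule diff_mem [OF _ m(5)]) simp_all
  moreover have "sl2_field 0 0 (H_M f) \<in> L"
    by (rule bracket_mem [OF m(3) m(6)]) (simp_all add: bracket_simps)
  ultimately show "H_M f \<in> coefficients L"
    by (simp add: coefficients_def)
qed

text \<open>Brackets of \<open>x \<Xi>, x \<Theta>, x H\<close> with \<open>f \<Xi>\<close> and \<open>f H\<close> produce products \<open>x f\<close>, but always together
  with products of \<open>x\<close> and a derivative of \<open>f\<close>. Since those derivatives are again admissible
  coefficients, the same brackets apply to them, and the resulting linear relations can be
  solved. In the comments of the proof, \<open>\<equiv>\<close> means equality modulo \<open>L\<close>.\<close>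

lemma coefficients_mult_coordinates:
  assumes 1: "1 \<in> coefficients L" and x: "x_M \<in> coefficients L" and f: "f \<in> coefficients L"
  shows "x_M * f \<in> coefficients L" "y_M * f \<in> coefficients L" "z_M * f \<in> coefficients L"
proof -
  note sl2 = coefficientsD [OF 1] and xD = coefficientsD [OF x]
  note stable = coefficients_sl2_stable [OF 1]
  have Xi_mod_H: "sl2_field (x_M * Theta_M g) 0 (x_M * g) \<in> L" if "g \<in> coefficients L" for g
    by (rule bracket_mem [OF xD(2) coefficientsD(1) [OF that]]) (simp_all add: bracket_simps)
  have eigen: "sl2_field (x_M * H_M g - 2 * (x_M * g)) 0 0 \<in> L" if "g \<in> coefficients L" for g
    by (rule bracket_mem [OF xD(3) coefficientsD(1) [OF that]])
       (simp_all add: bracket_simps algebra_simps)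
  \<comment> \<open>The relation \<open>x g H \<equiv> - x \<Theta>(g) \<Xi>\<close> turns \<open>x (H(g) + 2 g) H \<equiv> 0\<close> into a statement about
    \<open>\<Theta> (H + 2) g = H \<Theta> g\<close>, namely \<open>x H(\<Theta> g) \<Xi> \<equiv> 0\<close>. By the eigenvalue relation for \<open>\<Theta> g\<close> this
    is \<open>2 x \<Theta>(g) \<Xi>\<close>, so \<open>x \<Theta>(g) \<Xi>\<close> vanishes modulo \<open>L\<close>, and with it \<open>x g H\<close>.\<close>
  have x_H: "sl2_field 0 0 (x_M * g) \<in> L" if g: "g \<in> coefficients L" for g
  proof -
    have 1: "sl2_field 0 0 (x_M * H_M g + 2 * (x_M * g)) \<in> L"
      by (rule bracket_mem [OF xD(3) coefficientsD(3) [OF g]])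
         (simp_all add: bracket_simps algebra_simps)
    have 2: "sl2_field (x_M * H_M (Theta_M g)) 0 (x_M * H_M g + 2 * (x_M * g)) \<in> L"
      by (rule add_mem [OF add_mem [OF Xi_mod_H [OF g] Xi_mod_H [OF g] refl refl refl]
            Xi_mod_H [OF stable(3) [OF g]]])
         (simp_all add: bracket_simps algebra_simps)
    have "sl2_field (x_M * H_M (Theta_M g)) 0 0 \<in> L"
      by (rule diff_mem [OF 2 1]) simp_all
    from this eigen [OF stable(2) [OF g]]
    have "sl2_field (2 * (x_M * Theta_M g)) 0 0 \<in> L"
      by (rule diff_mem) simp_all
    then have "sl2_field (x_M * Theta_M g) 0 0 \<in> L"
      by (rule cancel_mem [where n = "num.Bit0 num.One"]) simp_all
    with Xi_mod_H [OF g] show ?thesis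
      by (rule diff_mem) simp_all
  qed
  have x_Xi: "sl2_field (x_M * g) 0 0 \<in> L" if g: "g \<in> coefficients L" for g
  proof -
    have "sl2_field (4 * (x_M * g)) 0 (x_M * Xi_M g) \<in> L"
      by (rule bracket_mem [OF xD(1) coefficientsD(3) [OF g]])
         (simp_all add: bracket_simps algebra_simps)
    from this x_H [OF stable(1) [OF g]] have "sl2_field (4 * (x_M * g)) 0 0 \<in> L"
      by (rule diff_mem) simp_all
    then show ?thesis
      by (rule cancel_mem [where n = "num.Bit0 (num.Bit0 num.One)"]) simp_all
  qed
  have z_Xi: "sl2_field (z_M * g) 0 0 \<in> L" if g: "g \<in> coefficients L" for g
  proof -
    have "sl2_field (2 * (z_M * g) + x_M * Theta_M g) 0 (x_M * g) \<in> L"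
      by (rule bracket_mem [OF sl2(2) x_Xi [OF g]]) (simp_all add: bracket_simps algebra_simps)
    from this x_H [OF g] have "sl2_field (2 * (z_M * g) + x_M * Theta_M g) 0 0 \<in> L"
      by (rule diff_mem) simp_all
    from this x_Xi [OF stable(2) [OF g]] have "sl2_field (2 * (z_M * g)) 0 0 \<in> L"
      by (rule diff_mem) simp_all
    then show ?thesis
      by (rule cancel_mem [where n = "num.Bit0 num.One"]) simp_all
  qed
  have z_H_mod_x_Theta: "sl2_field 0 (- (x_M * g)) (z_M * g) \<in> L" if g: "g \<in> coefficients L" for g
  proof -
    have "sl2_field 0 (- 2 * (x_M * g)) (2 * (z_M * g) + x_M * Theta_M g) \<in> L"
      by (rule bracket_mem [OF sl2(2) x_H [OF g]]) (simp_all add: bracket_simps algebra_simps)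
    from this x_H [OF stable(2) [OF g]]
    have "sl2_field 0 (- 2 * (x_M * g)) (2 * (z_M * g)) \<in> L"
      by (rule diff_mem) simp_all
    then show ?thesis
      by (rule cancel_mem [where n = "num.Bit0 num.One"]) simp_all
  qed
  \<comment> \<open>Applying \<open>[\<Theta>, _]\<close> to \<open>z g \<Xi>\<close> gives \<open>y g \<Xi> \<equiv> - z g H\<close>. By the syzygy the left side is
    \<open>x g \<Theta> + z g H\<close>, which is \<open>\<equiv> 2 z g H\<close>. Hence \<open>3 z g H \<equiv> 0\<close>.\<close>
  have z_H: "sl2_field 0 0 (z_M * g) \<in> L" if g: "g \<in> coefficients L" for g
  proof -
    have "sl2_field (y_M * g + z_M * Theta_M g) 0 (z_M * g) \<in> L"
      by (rule bracket_mem [OF sl2(2) z_Xi [OF g]]) (simp_all add: bracket_simps algebra_simps)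
    from this z_Xi [OF stable(2) [OF g]] have "sl2_field (y_M * g) 0 (z_M * g) \<in> L"
      by (rule diff_mem) simp_all
    then have b: "sl2_field 0 (x_M * g) (2 * (z_M * g)) \<in> L"
      by (rule syzygy_mem [where k = "- g"]) (simp_all add: algebra_simps)
    have "sl2_field 0 0 (3 * (z_M * g)) \<in> L"
      by (rule add_mem [OF z_H_mod_x_Theta [OF g] b]) simp_all
    then show ?thesis
      by (rule cancel_mem [where n = "num.Bit1 num.One"]) simp_all
  qed
  have x_Theta: "sl2_field 0 (x_M * g) 0 \<in> L" if g: "g \<in> coefficients L" for g
  proof -
    from z_H [OF g] z_H_mod_x_Theta [OF g] show ?thesis
      by (rule diff_mem) simp_all
  qed
  have y_Xi: "sl2_field (y_M * g) 0 0 \<in> L" if g: "g \<in> coefficients L" for g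
  proof -
    have "sl2_field 0 (x_M * g) (z_M * g) \<in> L"
      by (rule add_mem [OF x_Theta [OF g] z_H [OF g]]) simp_all
    then show ?thesis
      by (rule syzygy_mem [where k = g]) (simp_all add: algebra_simps)
  qed
  have z_Theta: "sl2_field 0 (z_M * g) 0 \<in> L" if g: "g \<in> coefficients L" for g
  proof -
    have "sl2_field 0 (2 * (z_M * g) + x_M * Theta_M g) 0 \<in> L"
      by (rule bracket_mem [OF sl2(2) x_Theta [OF g]]) (simp_all add: bracket_simps algebra_simps)
    from this x_Theta [OF stable(2) [OF g]] have "sl2_field 0 (2 * (z_M * g)) 0 \<in> L"
      by (rule diff_mem) simp_all
    then show ?thesis
      by (rule cancel_mem [where n = "num.Bit0 num.One"]) simp_all
  qed
  have y_Theta: "sl2_field 0 (y_M * g) 0 \<in> L" if g: "g \<in> coefficients L" for g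
  proof -
    have "sl2_field 0 (y_M * g + z_M * Theta_M g) 0 \<in> L"
      by (rule bracket_mem [OF sl2(2) z_Theta [OF g]]) (simp_all add: bracket_simps algebra_simps)
    from this z_Theta [OF stable(2) [OF g]] show ?thesis
      by (rule diff_mem) simp_all
  qed
  have y_H: "sl2_field 0 0 (y_M * g) \<in> L" if g: "g \<in> coefficients L" for g
  proof -
    have "sl2_field 0 0 (y_M * g + z_M * Theta_M g) \<in> L"
    proof -
      have "sl2_field 0 (- 2 * (z_M * g)) (y_M * g + z_M * Theta_M g) \<in> L"
        by (rule bracket_mem [OF sl2(2) z_H [OF g]]) (simp_all add: bracket_simps algebra_simps)
      from add_mem [OF this z_Theta [OF g] refl refl refl] z_Theta [OF g]
      show ?thesis
        by (rule add_mem) simp_all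
    qed
    from this z_H [OF stable(2) [OF g]] show ?thesis
      by (rule diff_mem) simp_all
  qed
  show "x_M * f \<in> coefficients L" "y_M * f \<in> coefficients L" "z_M * f \<in> coefficients L"
    by (rule coefficientsI; rule x_Xi x_Theta x_H y_Xi y_Theta y_H z_Xi z_Theta z_H; rule f)+
qed

lemma coefficients_eq_UNIV:
  assumes 1: "1 \<in> coefficients L" and x: "x_M \<in> coefficients L"
  shows "f \<in> coefficients L"
proof (induction f rule: coord_ring_induct)
  case (const c)
  show ?case
    using coefficientsD [OF 1, THEN scale_mem, of c] by (simp add: coefficients_def)
next
  case (add f g)
  note m = coefficientsD [OF add.IH(1)] coefficientsD [OF add.IH(2)]
  show ?case
    unfolding coefficients_def
    by (auto intro: add_mem [OF m(1) m(4)] add_mem [OF m(2) m(5)] add_mem [OF m(3) m(6)])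
qed (rule coefficients_mult_coordinates [OF 1 x]; assumption)+

lemma sl2_field_mem:
  assumes "1 \<in> coefficients L" "x_M \<in> coefficients L"
  shows "sl2_field f g h \<in> L"
proof -
  note m = coefficientsD [OF coefficients_eq_UNIV [OF assms]]
  have "sl2_field f g 0 \<in> L"
    by (rule add_mem [OF m(1) m(2)]) simp_all
  then show ?thesis
    by (rule add_mem [OF _ m(3)]) simp_all
qed

lemma generators_give_coefficients:
  assumes Xi: "sl2_field 1 0 0 \<in> L" and Theta: "sl2_field 0 1 0 \<in> L"
    and zXi: "sl2_field z_M 0 0 \<in> L" and zH: "sl2_field 0 0 z_M \<in> L"
  shows "1 \<in> coefficients L" "x_M \<in> coefficients L"
proof -
  have "sl2_field 0 0 1 \<in> L"
    by (rule bracket_mem [OF Theta Xi]) (simp_all add: bracket_simps)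
  with Xi Theta show "1 \<in> coefficients L"
    by (simp add: coefficients_def)
  have "sl2_field (2 * z_M) 0 x_M \<in> L"
    by (rule bracket_mem [OF Xi zH]) (simp_all add: bracket_simps)
  from diff_mem [OF this zXi refl refl refl] zXi have xH: "sl2_field 0 0 x_M \<in> L"
    by (rule diff_mem) simp_all
  have "sl2_field y_M 0 z_M \<in> L"
    by (rule bracket_mem [OF Theta zXi]) (simp_all add: bracket_simps)
  from this zH have "sl2_field y_M 0 0 \<in> L"
    by (rule diff_mem) simp_all
  from diff_mem [OF this zH refl refl refl] have xTheta: "sl2_field 0 x_M 0 \<in> L"
    by (rule syzygy_mem [where k = "- 1"]) simp_all
  have "sl2_field (2 * x_M) 0 0 \<in> L"
    by (rule bracket_mem [OF Xi xH]) (simp_all add: bracket_simps)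
  then have "sl2_field x_M 0 0 \<in> L"
    by (rule cancel_mem [where n = "num.Bit0 num.One"]) simp_all
  with xH xTheta show "x_M \<in> coefficients L"
    by (simp add: coefficients_def)
qed

end

theorem theorem19:
  shows "H_M = lie_bracket Theta_M Xi_M \<and>
    (\<forall>D \<in> {Xi_M, Theta_M, smult_field z_M Xi_M, smult_field z_M H_M}. complete_vector_field D) \<and>
    lie_generated {Xi_M, Theta_M, smult_field z_M Xi_M, smult_field z_M H_M} =
      {add_field (smult_field f Xi_M) (add_field (smult_field g Theta_M) (smult_field h H_M))
        | f g h. True}"
proof (intro conjI)
  show "H_M = lie_bracket Theta_M Xi_M"
    by (simp add: bracket_Theta_Xi)
  show "\<forall>D \<in> {Xi_M, Theta_M, smult_field z_M Xi_M, smult_field z_M H_M}. complete_vector_field D"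
    by (simp add: complete_Xi complete_Theta complete_z_Xi complete_z_H)
  have generators: "{Xi_M, Theta_M, smult_field z_M Xi_M, smult_field z_M H_M} =
      {sl2_field 1 0 0, sl2_field 0 1 0, sl2_field z_M 0 0, sl2_field 0 0 z_M}"
    by (simp add: sl2_field_def add_field_def smult_field_def)
  have "lie_generated {Xi_M, Theta_M, smult_field z_M Xi_M, smult_field z_M H_M} =
      {sl2_field f g h | f g h. True}"
    unfolding lie_generated_def generators
  proof (rule hull_unique)
    show "lie_subalgebra {sl2_field f g h | f g h. True}"
      by (rule lie_subalgebra_sl2_fields)
  next
    fix L
    assume "{sl2_field 1 0 0, sl2_field 0 1 0, sl2_field z_M 0 0, sl2_field 0 0 z_M} \<subseteq> L"
      and L: "lie_subalgebra L"
    then have "1 \<in> coefficients L" "x_M \<in> coefficients L"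
      by (intro generators_give_coefficients [OF L]; simp)+
    then have "sl2_field f g h \<in> L" for f g h
      by (rule sl2_field_mem [OF L])
    then show "{sl2_field f g h | f g h. True} \<subseteq> L"
      by blast
  qed blast
  then show "lie_generated {Xi_M, Theta_M, smult_field z_M Xi_M, smult_field z_M H_M} =
      {add_field (smult_field f Xi_M) (add_field (smult_field g Theta_M) (smult_field h H_M))
        | f g h. True}"
    by (simp add: sl2_field_def)
qed

end
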